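(* There exists a monotonically growing temporal grid $\mathcal{G}$ (that is, a monotonically growing temporal graph whose underlying static graph is a grid graph) such that there is no Nash equilibrium in the two-player temporal Voronoi game $\mathrm{Vor}(\mathcal{G},2)$.
   Context: A temporal graph $\mathcal{G}=(V,(E_t)_{t=1}^\infty)$ consists of a finite nonempty vertex set $V$ and an infinite sequence of edge sets $E_t\subseteq\binom{V}{2}$; it is assumed that the sequence is eventually constant (finite lifetime), i.e. there is $\tau$ with $E_t=E_\tau$ for all $t\ge\tau$. The underlying static graph is $(V,\bigcup_{t\ge1}E_t)$. With $[n]=\{1,\dots,n\}$, an $(n\times m)$-grid graph is a static graph isomorphic to $([n]\times[m],\{\{(i,j),(i',j')\}\mid |i-i'|+|j-j'|=1\})$. A temporal grid is a temporal graph whose underlying graph is an $(n\times m)$-grid graph for some $n,m$. $\mathcal{G}$ is monotonically growing if $E_t\subseteq E_{t+1}$ for all $t\ge 1$. A temporal walk from $u$ to $v$ is a sequence $(\{v_0=u,v_1\},t_1),(\{v_1,v_2\},t_2),\dots,(\{v_{d-1},v_d=v\},t_d)$ with $t_i<t_{i+1}$ for all $i\in\{1,\dots,d-1\}$ (strictly increasing times) and $\{v_{i-1},v_i\}\in E_{t_i}$ for all $i\in\{1,\dots,d\}$; its arrival time is $t_d$. The temporal distance $\mathrm{td}(u,v)$ is the minimum arrival time of a temporal walk from $u$ to $v$, with $\mathrm{td}(u,u)=0$ and $\mathrm{td}(u,v)=\infty$ if there is no such walk. In the two-player temporal Voronoi game $\mathrm{Vor}(\mathcal{G},2)$, each player $i\in\{1,2\}$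 selects one vertex $p_i\in V$ (equal choices are allowed). Player $i$ wins the set $U_i(p_1,p_2)=\{v\in V\mid \mathrm{td}(p_i,v)<\mathrm{td}(p_j,v)\}$, where $j\ne i$ is the other player, and her payoff is $u_i(p_1,p_2)=|U_i(p_1,p_2)|$. A profile $(p_1,p_2)\in V^2$ is a Nash equilibrium if $u_1(p',p_2)\le u_1(p_1,p_2)$ and $u_2(p_1,p')\le u_2(p_1,p_2)$ for all $p'\in V$. *)

theory Defs
  imports Main "HOL-Library.Extended_Nat"
begin

(* A temporal graph is given by a vertex set V and a sequence E of edge sets, an edge being a
   two-element set of vertices. Time steps start at 1; the value E 0 is never used. *)

definition temporal_graph :: "'a set \<Rightarrow> (nat \<Rightarrow> 'a set set) \<Rightarrow> bool" where
  "temporal_graph V E \<longleftrightarrow>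
     finite V \<and> V \<noteq> {} \<and>
     (\<forall>t\<ge>1. E t \<subseteq> {e. e \<subseteq> V \<and> card e = 2}) \<and>
     (\<exists>\<tau>\<ge>1. \<forall>t\<ge>\<tau>. E t = E \<tau>)"

definition underlying_edges :: "(nat \<Rightarrow> 'a set set) \<Rightarrow> 'a set set" where
  "underlying_edges E = (\<Union>t\<in>{1..}. E t)"

definition monotonically_growing :: "(nat \<Rightarrow> 'a set set) \<Rightarrow> bool" where
  "monotonically_growing E \<longleftrightarrow> (\<forall>t\<ge>1. E t \<subseteq> E (t + 1))"

definition graph_isomorphic ::
  "'a set \<Rightarrow> 'a set set \<Rightarrow> 'b set \<Rightarrow> 'b set set \<Rightarrow> bool" where
  "graph_isomorphic V F V' F' \<longleftrightarrow> (\<exists>f. bij_betw f V V' \<and> F' = (\<lambda>e. f ` e) ` F)"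

definition grid_vertices :: "nat \<Rightarrow> nat \<Rightarrow> (nat \<times> nat) set" where
  "grid_vertices n m = {1..n} \<times> {1..m}"

definition grid_edges :: "nat \<Rightarrow> nat \<Rightarrow> (nat \<times> nat) set set" where
  "grid_edges n m =
     {{(i, j), (i', j')} | i j i' j'.
        (i, j) \<in> grid_vertices n m \<and> (i', j') \<in> grid_vertices n m \<and>
        \<bar>int i - int i'\<bar> + \<bar>int j - int j'\<bar> = 1}"

definition grid_graph :: "'a set \<Rightarrow> 'a set set \<Rightarrow> bool" where
  "grid_graph V F \<longleftrightarrow>
     (\<exists>n\<ge>1. \<exists>m\<ge>1. graph_isomorphic (grid_vertices n m) (grid_edges n m) V F)"

definition temporal_grid :: "'a set \<Rightarrow> (nat \<Rightarrow> 'a set set) \<Rightarrow> bool" where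
  "temporal_grid V E \<longleftrightarrow> temporal_graph V E \<and> grid_graph V (underlying_edges E)"

(* Walks have at least one step; the case u = v without a step is covered by temporal_dist. *)

definition temporal_walk ::
  "(nat \<Rightarrow> 'a set set) \<Rightarrow> 'a \<Rightarrow> 'a \<Rightarrow> ('a set \<times> nat) list \<Rightarrow> bool" where
  "temporal_walk E u v w \<longleftrightarrow>
     w \<noteq> [] \<and> sorted_wrt (<) (map snd w) \<and>
     (\<exists>vs. length vs = length w + 1 \<and> hd vs = u \<and> last vs = v \<and>
        (\<forall>i<length w. fst (w ! i) = {vs ! i, vs ! (i + 1)} \<and>
                      snd (w ! i) \<ge> 1 \<and> fst (w ! i) \<in> E (snd (w ! i))))"

definition arrival_time :: "('a set \<times> nat) list \<Rightarrow> nat" where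
  "arrival_time w = snd (last w)"

(* In enat, the infimum of a nonempty set is its minimum, and the infimum of {} is infinity. *)

definition temporal_dist :: "(nat \<Rightarrow> 'a set set) \<Rightarrow> 'a \<Rightarrow> 'a \<Rightarrow> enat" where
  "temporal_dist E u v =
     (if u = v then 0 else Inf {enat (arrival_time w) | w. temporal_walk E u v w})"

(* The set won by the player at p against an opponent at q. The rules are the same for both
   players, so U_1(p1, p2) is won_set V E p1 p2 and U_2(p1, p2) is won_set V E p2 p1. *)

definition won_set :: "'a set \<Rightarrow> (nat \<Rightarrow> 'a set set) \<Rightarrow> 'a \<Rightarrow> 'a \<Rightarrow> 'a set" where
  "won_set V E p q = {v \<in> V. temporal_dist E p v < temporal_dist E q v}"

definition payoff1 :: "'a set \<Rightarrow> (nat \<Rightarrow> 'a set set) \<Rightarrow> 'a \<Rightarrow> 'a \<Rightarrow> nat" where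
  "payoff1 V E p1 p2 = card (won_set V E p1 p2)"

definition payoff2 :: "'a set \<Rightarrow> (nat \<Rightarrow> 'a set set) \<Rightarrow> 'a \<Rightarrow> 'a \<Rightarrow> nat" where
  "payoff2 V E p1 p2 = card (won_set V E p2 p1)"

definition nash_equilibrium :: "'a set \<Rightarrow> (nat \<Rightarrow> 'a set set) \<Rightarrow> 'a \<Rightarrow> 'a \<Rightarrow> bool" where
  "nash_equilibrium V E p1 p2 \<longleftrightarrow>
     p1 \<in> V \<and> p2 \<in> V \<and>
     (\<forall>p'\<in>V. payoff1 V E p' p2 \<le> payoff1 V E p1 p2 \<and>
             payoff2 V E p1 p' \<le> payoff2 V E p1 p2)"

end

theory Submission
  imports Defs
begin

text \<open>
  The witness, found by computer search, is a \<open>2 \<times> 4\<close> grid in which every edge is labelled with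
  the time at which it appears. Its best replies run in a cycle
  \<open>{(1,1), (1,2)} \<rightarrow> (1,3) \<rightarrow> {(1,4), (2,3), (2,4)} \<rightarrow> (2,2) \<rightarrow> {(1,1), (1,2)}\<close>,
  each arrow leading from any vertex on its left to the set of all best replies to it.
  The remaining vertex \<open>(2,1)\<close> is never a best reply, so no two vertices are best replies to each
  other. The temporal distances are certified by a potential \<open>d\<close> in the manner of Bellman's
  equations: along every edge \<open>d\<close> grows at most as fast as arrival times do, and every vertex other
  than the source has an incoming edge attaining this bound.
\<close>

section \<open>Temporal walks and certificates for temporal distances\<close>

lemma temporal_walk_singleton:
  assumes "{u, v} \<in> E t" and "1 \<le> t"
  shows "temporal_walk E u v [({u, v}, t)]"
  unfolding temporal_walk_def using assms by (auto intro!: exI[of _ "[u, v]"])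

lemma temporal_walk_snoc:
  assumes w: "temporal_walk E u x w" and t: "arrival_time w < t" and e: "{x, v} \<in> E t"
  shows "temporal_walk E u v (w @ [({x, v}, t)])"
proof -
  from w obtain vs where ne: "w \<noteq> []" and srt: "sorted_wrt (<) (map snd w)"
    and len: "length vs = length w + 1" and hd: "hd vs = u" and lst: "last vs = x"
    and st: "\<And>i. i < length w \<Longrightarrow> fst (w ! i) = {vs ! i, vs ! (i + 1)} \<and>
                snd (w ! i) \<ge> 1 \<and> fst (w ! i) \<in> E (snd (w ! i))"
    unfolding temporal_walk_def by blast
  have vne: "vs \<noteq> []"
    using len by auto
  \<comment> \<open>Times increase strictly, so the last one is the largest and \<open>t\<close>
    need only be compared with it.\<close>
  have late: "s \<le> arrival_time w" if s: "s \<in> set (map snd w)" for s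
  proof -
    from s obtain i where i: "i < length w" "s = snd (w ! i)"
      by (auto simp: in_set_conv_nth)
    then show ?thesis
      using srt ne
      by (cases "i = length w - 1")
        (auto simp: arrival_time_def last_conv_nth sorted_wrt_iff_nth_less intro: less_imp_le)
  qed
  have xi: "vs ! length w = x"
    using lst len vne by (simp add: last_conv_nth)
  have "sorted_wrt (<) (map snd (w @ [({x, v}, t)]))"
    using srt late t by (fastforce simp: sorted_wrt_append)
  moreover have "\<forall>i<length (w @ [({x, v}, t)]).
      fst ((w @ [({x, v}, t)]) ! i) = {(vs @ [v]) ! i, (vs @ [v]) ! (i + 1)} \<and>
      snd ((w @ [({x, v}, t)]) ! i) \<ge> 1 \<and>
      fst ((w @ [({x, v}, t)]) ! i) \<in> E (snd ((w @ [({x, v}, t)]) ! i))"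
  proof (intro allI impI)
    fix i assume i: "i < length (w @ [({x, v}, t)])"
    show "fst ((w @ [({x, v}, t)]) ! i) = {(vs @ [v]) ! i, (vs @ [v]) ! (i + 1)} \<and>
      snd ((w @ [({x, v}, t)]) ! i) \<ge> 1 \<and>
      fst ((w @ [({x, v}, t)]) ! i) \<in> E (snd ((w @ [({x, v}, t)]) ! i))"
    proof (cases "i < length w")
      case True
      then show ?thesis
        using st[OF True] len by (auto simp add: nth_append)
    next
      case False
      then have "i = length w"
        using i by simp
      then show ?thesis
        using e t xi len by (simp add: nth_append)
    qed
  qed
  moreover have "length (vs @ [v]) = length (w @ [({x, v}, t)]) + 1"
    "hd (vs @ [v]) = u" "last (vs @ [v]) = v"
    using len hd vne by simp_all
  ultimately show ?thesis
    unfolding temporal_walk_def by blast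
qed

text \<open>Each step of a walk departs strictly after the arrival at its start vertex, so
  \<open>step\<close> carries the bound "\<open>d\<close> is at most the time of arrival" from every
  vertex of the walk to the next.\<close>

lemma potential_le_arrival_time:
  fixes d :: "'a \<Rightarrow> nat"
  assumes source: "d u = 0"
    and step: "\<And>t x y. {x, y} \<in> E t \<Longrightarrow> d x < t \<Longrightarrow> d y \<le> t"
    and w: "temporal_walk E u v w"
  shows "d v \<le> arrival_time w"
proof -
  from w obtain vs where ne: "w \<noteq> []" and srt: "sorted_wrt (<) (map snd w)"
    and len: "length vs = length w + 1" and hd: "hd vs = u" and lst: "last vs = v"
    and st: "\<And>i. i < length w \<Longrightarrow> fst (w ! i) = {vs ! i, vs ! (i + 1)} \<and>
                snd (w ! i) \<ge> 1 \<and> fst (w ! i) \<in> E (snd (w ! i))"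
    unfolding temporal_walk_def by blast
  have vne: "vs \<noteq> []"
    using len by auto
  have "i < length w \<Longrightarrow> d (vs ! (i + 1)) \<le> snd (w ! i)" for i
  proof (induction i)
    \<comment> \<open>The source has potential 0 and times start at 1, so the premise
      \<open>d x < t\<close> of \<open>step\<close> holds at the first edge.\<close>
    case 0
    then show ?case
      using st[of 0] hd vne source by (intro step[of "vs ! 0"]) (auto simp: hd_conv_nth)
  next
    case (Suc i)
    then have "snd (w ! i) < snd (w ! Suc i)"
      using srt by (simp add: sorted_wrt_iff_nth_less)
    then show ?case
      using st[of "Suc i"] Suc by (intro step[of "vs ! Suc i"]) auto
  qed
  from this[of "length w - 1"] show ?thesis
    using ne vne lst len by (simp add: arrival_time_def last_conv_nth)
qed

text \<open>Following \<open>tight\<close> backwards from \<open>v\<close> strictly decreases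
  \<open>d\<close> and so ends at \<open>u\<close>; reversed, this is a walk reaching each of its
  vertices \<open>y\<close> other than \<open>u\<close> at time \<open>d y\<close>. By
  \<open>potential_le_arrival_time\<close> no walk arrives earlier.\<close>

lemma temporal_dist_eqI:
  fixes d :: "'a \<Rightarrow> nat"
  assumes source: "d u = 0"
    and step: "\<And>t x y. {x, y} \<in> E t \<Longrightarrow> d x < t \<Longrightarrow> d y \<le> t"
    and tight: "\<And>y. y \<in> V \<Longrightarrow> y \<noteq> u \<Longrightarrow> \<exists>x\<in>V. d x < d y \<and> {x, y} \<in> E (d y)"
    and "v \<in> V"
  shows "temporal_dist E u v = enat (d v)"
proof (cases "v = u")
  case True
  then show ?thesis
    using source by (simp add: temporal_dist_def zero_enat_def)
next
  case False
  have "\<exists>w. temporal_walk E u v w \<and> arrival_time w = d v"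
    using \<open>v \<in> V\<close> False
  proof (induction "d v" arbitrary: v rule: less_induct)
    case less
    obtain x where x: "x \<in> V" "d x < d v" "{x, v} \<in> E (d v)"
      using tight less.prems by blast
    show ?case
    \<comment> \<open>Walks are nonempty, so the induction hypothesis gives none from
      \<open>u\<close> to itself: an edge leaving the source has to start the walk.\<close>
    proof (cases "x = u")
      case True
      then have "temporal_walk E u v [({u, v}, d v)]"
        using x by (intro temporal_walk_singleton) auto
      then show ?thesis
        by (force simp: arrival_time_def)
    next
      case False
      then obtain w where "temporal_walk E u x w" "arrival_time w = d x"
        using less.hyps x by blast
      then have "temporal_walk E u v (w @ [({x, v}, d v)])"
        using x by (intro temporal_walk_snoc) auto
      then show ?thesis
        by (force simp: arrival_time_def)
    qed
  qed
  then have "enat (d v) \<in> {enat (arrival_time w) | w. temporal_walk E u v w}"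
    by force
  then have "Inf {enat (arrival_time w) | w. temporal_walk E u v w} = enat (d v)"
  proof (intro antisym Inf_greatest Inf_lower)
    fix a assume "a \<in> {enat (arrival_time w) | w. temporal_walk E u v w}"
    then obtain w where "a = enat (arrival_time w)" "temporal_walk E u v w"
      by blast
    then show "enat (d v) \<le> a"
      using potential_le_arrival_time[where d = d, OF source step] by simp
  qed
  then show ?thesis
    using False by (simp add: temporal_dist_def)
qed

section \<open>The labelled grid and its finite checks\<close>

definition vertices :: "(nat \<times> nat) list" where
  "vertices = List.product [1, 2] [1, 2, 3, 4]"

text \<open>Each undirected edge is stored in one orientation only, whence the symmetric
  disjunctions and conjunctions in the checks below.\<close>

definition labelled_edges :: "((nat \<times> nat) \<times> (nat \<times> nat) \<times> nat) list" where
  "labelled_edges =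
    [((1, 1), (1, 2), 1), ((1, 2), (1, 3), 3), ((1, 3), (1, 4), 3),
     ((1, 1), (2, 1), 2), ((1, 2), (2, 2), 3), ((1, 3), (2, 3), 3), ((1, 4), (2, 4), 1),
     ((2, 1), (2, 2), 3), ((2, 2), (2, 3), 3), ((2, 3), (2, 4), 1)]"

definition edges :: "nat \<Rightarrow> (nat \<times> nat) set set" where
  "edges t = {{x, y} | x y l. (x, y, l) \<in> set labelled_edges \<and> l \<le> t}"

text \<open>Row \<open>u\<close> and column \<open>v\<close> follow the order of
  \<open>vertices\<close>. The table can be evaluated, unlike an infimum over walks;
  \<open>arrival_source\<close>, \<open>arrival_step\<close> and \<open>arrival_tight\<close>
  certify its entries.\<close>

definition arrival :: "nat \<times> nat \<Rightarrow> nat \<times> nat \<Rightarrow> nat" where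
  "arrival u v =
     (let index = (\<lambda>(i, j). 4 * (i - 1) + (j - 1))
      in [[0, 1, 3, 4, 2, 3, 4, 5],
          [1, 0, 3, 4, 2, 3, 4, 5],
          [4, 3, 0, 3, 5, 4, 3, 4],
          [5, 4, 3, 0, 4, 3, 2, 1],
          [2, 3, 4, 5, 0, 3, 4, 5],
          [4, 3, 4, 5, 3, 0, 3, 4],
          [5, 4, 3, 2, 4, 3, 0, 1],
          [5, 4, 3, 1, 4, 3, 1, 0]] ! index u ! index v)"

definition payoff :: "nat \<times> nat \<Rightarrow> nat \<times> nat \<Rightarrow> nat" where
  "payoff p q = length (filter (\<lambda>v. arrival p v < arrival q v) vertices)"

lemma set_vertices: "set vertices = grid_vertices 2 4"
proof -
  have "{1..2::nat} = {1, 2}" "{1..4::nat} = {1, 2, 3, 4}"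
    by (simp_all add: set_eq_iff, presburger+)
  then show ?thesis
    unfolding vertices_def grid_vertices_def set_product by simp
qed

lemma labelled_edges_adjacent:
  "\<forall>(x, y, l)\<in>set labelled_edges. x \<in> set vertices \<and> y \<in> set vertices \<and> x \<noteq> y \<and> l \<in> {1, 2, 3} \<and>
     \<bar>int (fst x) - int (fst y)\<bar> + \<bar>int (snd x) - int (snd y)\<bar> = 1"
  by code_simp

lemma adjacent_labelled_edges:
  "\<forall>x\<in>set vertices. \<forall>y\<in>set vertices.
     \<bar>int (fst x) - int (fst y)\<bar> + \<bar>int (snd x) - int (snd y)\<bar> = 1 \<longrightarrow>
     (\<exists>(a, b, l)\<in>set labelled_edges. a = x \<and> b = y \<or> a = y \<and> b = x)"
  by code_simp

lemma arrival_source: "\<forall>u\<in>set vertices. arrival u u = 0"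
  by code_simp

text \<open>An edge labelled \<open>l\<close> never disappears, so from \<open>x\<close> it can be
  taken at the first time that is later than the arrival at \<open>x\<close> and at least
  \<open>l\<close>.\<close>

lemma arrival_step:
  "\<forall>u\<in>set vertices. \<forall>(x, y, l)\<in>set labelled_edges.
     arrival u y \<le> max (arrival u x + 1) l \<and> arrival u x \<le> max (arrival u y + 1) l"
  by code_simp

text \<open>Equality holds at the last edge of an earliest walk.\<close>

lemma arrival_tight:
  "\<forall>u\<in>set vertices. \<forall>v\<in>set vertices. v = u \<or>
     (\<exists>(x, y, l)\<in>set labelled_edges.
        y = v \<and> arrival u v = max (arrival u x + 1) l \<or>
        x = v \<and> arrival u v = max (arrival u y + 1) l)"
  by code_simp

text \<open>In the first disjunct \<open>r\<close> is a better reply than \<open>p\<close> to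
  \<open>q\<close>, in the second a better reply than \<open>q\<close> to \<open>p\<close>. All 64
  profiles are evaluated, equal choices included.\<close>

lemma payoff_improvable:
  "\<forall>p\<in>set vertices. \<forall>q\<in>set vertices. \<exists>r\<in>set vertices.
     payoff p q < payoff r q \<or> payoff q p < payoff r p"
  by code_simp

section \<open>The witness as a growing temporal grid\<close>

text \<open>The largest label is 3. This gives both the finite lifetime and the underlying
  graph.\<close>

lemma edges_eq_grid_edges:
  assumes "3 \<le> t"
  shows "edges t = grid_edges 2 4"
proof (intro equalityI subsetI)
  fix e assume "e \<in> edges t"
  then obtain i j i' j' l where e: "e = {(i, j), (i', j')}"
    and l: "((i, j), (i', j'), l) \<in> set labelled_edges"
    unfolding edges_def by auto
  have "(i, j) \<in> grid_vertices 2 4" "(i', j') \<in> grid_vertices 2 4"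
    "\<bar>int i - int i'\<bar> + \<bar>int j - int j'\<bar> = 1"
    using bspec[OF labelled_edges_adjacent l] by (simp_all add: set_vertices)
  with e show "e \<in> grid_edges 2 4"
    unfolding grid_edges_def by blast
next
  fix e assume "e \<in> grid_edges 2 4"
  then obtain x y where e: "e = {x, y}" and xy: "x \<in> set vertices" "y \<in> set vertices"
    "\<bar>int (fst x) - int (fst y)\<bar> + \<bar>int (snd x) - int (snd y)\<bar> = 1"
    unfolding grid_edges_def set_vertices by auto
  then obtain a b l where l: "(a, b, l) \<in> set labelled_edges" "a = x \<and> b = y \<or> a = y \<and> b = x"
    using adjacent_labelled_edges by blast
  then have "l \<le> t"
    using bspec[OF labelled_edges_adjacent l(1)] assms by auto
  moreover have "e = {a, b}"
    using l(2) e by (auto simp: insert_commute)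
  ultimately show "e \<in> edges t"
    using l(1) unfolding edges_def by blast
qed

lemma edges_mono: "s \<le> t \<Longrightarrow> edges s \<subseteq> edges t"
  unfolding edges_def using le_trans by fast

lemma underlying_edges_edges: "underlying_edges edges = grid_edges 2 4"
proof
  have "edges t \<subseteq> grid_edges 2 4" for t
    \<comment> \<open>Passing to \<open>max t 3\<close> also covers the times before the grid is
      complete.\<close>
    using edges_mono[of t "max t 3"] edges_eq_grid_edges[of "max t 3"] by simp
  then show "underlying_edges edges \<subseteq> grid_edges 2 4"
    unfolding underlying_edges_def by blast
  show "grid_edges 2 4 \<subseteq> underlying_edges edges"
    unfolding underlying_edges_def using edges_eq_grid_edges[of 3] by fastforce
qed

lemma temporal_grid_edges: "temporal_grid (set vertices) edges"
  unfolding temporal_grid_def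
proof
  have "edges t \<subseteq> {e. e \<subseteq> set vertices \<and> card e = 2}" for t
  proof
    fix e assume "e \<in> edges t"
    then obtain x y l where e: "e = {x, y}" and l: "(x, y, l) \<in> set labelled_edges"
      unfolding edges_def by blast
    have "x \<in> set vertices" "y \<in> set vertices" "x \<noteq> y"
      using bspec[OF labelled_edges_adjacent l] by simp_all
    then show "e \<in> {e. e \<subseteq> set vertices \<and> card e = 2}"
      by (simp add: e)
  qed
  moreover have "\<exists>\<tau>\<ge>1. \<forall>t\<ge>\<tau>. edges t = edges \<tau>"
    using edges_eq_grid_edges by (intro exI[of _ 3]) simp
  moreover have "set vertices \<noteq> {}"
    by (simp add: vertices_def)
  ultimately show "temporal_graph (set vertices) edges"
    unfolding temporal_graph_def by blast
  have "graph_isomorphic (grid_vertices 2 4) (grid_edges 2 4) (set vertices) (underlying_edges edges)"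
    unfolding graph_isomorphic_def set_vertices underlying_edges_edges
    by (intro exI[of _ id]) simp
  then show "grid_graph (set vertices) (underlying_edges edges)"
    unfolding grid_graph_def by (intro exI[of _ 2] exI[of _ 4] conjI) auto
qed

section \<open>Temporal distances and payoffs of the witness\<close>

lemma temporal_dist_edges:
  assumes u: "u \<in> set vertices" and v: "v \<in> set vertices"
  shows "temporal_dist edges u v = enat (arrival u v)"
proof (rule temporal_dist_eqI[where V = "set vertices"])
  show "arrival u u = 0"
    using arrival_source u by blast
  show "arrival u y \<le> t" if "{x, y} \<in> edges t" "arrival u x < t" for t x y
  proof -
    from that obtain a b l where "(a, b, l) \<in> set labelled_edges" "l \<le> t"
      "a = x \<and> b = y \<or> a = y \<and> b = x"
      unfolding edges_def by (auto simp: doubleton_eq_iff)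
    \<comment> \<open>Both \<open>arrival u x + 1\<close> and \<open>l\<close> are at most
      \<open>t\<close>, hence so is their maximum.\<close>
    then show ?thesis
      using bspec[OF bspec[OF arrival_step u], of "(a, b, l)"] that(2) by auto
  qed
  show "\<exists>x\<in>set vertices. arrival u x < arrival u y \<and> {x, y} \<in> edges (arrival u y)"
    if "y \<in> set vertices" "y \<noteq> u" for y
  proof -
    from that u arrival_tight obtain a b l where ab: "(a, b, l) \<in> set labelled_edges"
      and eq: "b = y \<and> arrival u y = max (arrival u a + 1) l \<or>
               a = y \<and> arrival u y = max (arrival u b + 1) l"
      by blast
    have vs: "a \<in> set vertices" "b \<in> set vertices"
      using bspec[OF labelled_edges_adjacent ab] by simp_all
    \<comment> \<open>The edge attaining the maximum has already appeared at the time it is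
      needed.\<close>
    have "l \<le> arrival u y"
      using eq by auto
    with ab have mem: "{a, b} \<in> edges (arrival u y)"
      unfolding edges_def by blast
    from eq show ?thesis
    proof
      assume *: "b = y \<and> arrival u y = max (arrival u a + 1) l"
      then have "arrival u a < arrival u y"
        by simp
      with * vs mem show ?thesis
        by blast
    next
      assume *: "a = y \<and> arrival u y = max (arrival u b + 1) l"
      then have "arrival u b < arrival u y" "{b, y} \<in> edges (arrival u y)"
        using mem by (simp_all add: insert_commute)
      with vs show ?thesis
        by blast
    qed
  qed
qed (rule v)

lemma card_won_set:
  assumes "p \<in> set vertices" and "q \<in> set vertices"
  shows "card (won_set (set vertices) edges p q) = payoff p q"
proof -
  have "won_set (set vertices) edges p q = set (filter (\<lambda>v. arrival p v < arrival q v) vertices)"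
    using assms by (auto simp: won_set_def temporal_dist_edges)
  \<comment> \<open>Without repetitions, the length of the filtered list is a cardinality.\<close>
  moreover have "distinct vertices"
    by (simp add: vertices_def)
  ultimately show ?thesis
    by (simp add: payoff_def distinct_card del: set_filter)
qed

theorem theorem10:
  shows "\<exists>(V :: (nat \<times> nat) set) (E :: nat \<Rightarrow> (nat \<times> nat) set set).
           temporal_grid V E \<and> monotonically_growing E \<and>
           \<not> (\<exists>p1 p2. nash_equilibrium V E p1 p2)"
proof (intro exI conjI)
  show "temporal_grid (set vertices) edges"
    by (rule temporal_grid_edges)
  show "monotonically_growing edges"
    by (simp add: monotonically_growing_def edges_mono)
  show "\<not> (\<exists>p1 p2. nash_equilibrium (set vertices) edges p1 p2)"
  proof clarify
    fix p q assume nash: "nash_equilibrium (set vertices) edges p q"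
    then have pq: "p \<in> set vertices" "q \<in> set vertices"
      by (simp_all add: nash_equilibrium_def)
    with payoff_improvable obtain r where r: "r \<in> set vertices"
      "payoff p q < payoff r q \<or> payoff q p < payoff r p"
      by blast
    \<comment> \<open>The second player's payoff is \<open>payoff\<close> with the arguments
      swapped, so her deviation to \<open>r\<close> yields \<open>payoff r p\<close>.\<close>
    have "payoff r q \<le> payoff p q \<and> payoff r p \<le> payoff q p"
      using nash pq r(1)
      by (auto simp: nash_equilibrium_def payoff1_def payoff2_def card_won_set)
    with r(2) show False
      by linarith
  qed
qed

end
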